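(* For integers $n, m \geq 0$, let $cp_{1-1}(n, m)$ denote the number of partitions of $n$ into $m$ parts $\lambda_1 \leq \cdots \leq \lambda_m$ such that $\lambda_{i+1} - \lambda_i \geq 2$ for all $i$, and $\lambda_{i+1} - \lambda_i \geq 4$ unless $\lambda_i + \lambda_{i+1} \equiv 1 \pmod{3}$. Then \[ \sum_{m, n \geq 0} cp_{1-1}(n,m) q^n x^m = \sum_{n_1, n_2 \geq 0} \frac{ q^{6n_2^2 - 2n_2 + 2n_1^2 - n_1 + 6n_2 n_1} x^{2n_2 + n_1} }{ (q; q)_{n_1} (q^3; q^3)_{n_2} }. \]
   Context: A partition of $n$ into $m$ parts is a non-decreasing sequence of $m$ positive integers summing to $n$. For $n \geq 0$, $(a; q)_n = \prod_{j=1}^{n} (1 - a q^{j-1})$, with the empty product equal to $1$. *)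

theory Defs
  imports "HOL-Analysis.Analysis" "HOL-Number_Theory.Cong"
    "HOL-Computational_Algebra.Formal_Power_Series"
begin

definition qpoch :: "'a::comm_ring_1 \<Rightarrow> 'a \<Rightarrow> nat \<Rightarrow> 'a" where
  "qpoch a q n = (\<Prod>j=1..n. 1 - a * q ^ (j - 1))"

definition is_partition :: "nat \<Rightarrow> nat \<Rightarrow> nat list \<Rightarrow> bool" where
  "is_partition n m ps \<longleftrightarrow>
     length ps = m \<and> sorted ps \<and> (\<forall>p\<in>set ps. p > 0) \<and> sum_list ps = n"

text \<open>List indices start at 0, so \<open>ps ! i\<close> is $\lambda_{i+1}$.\<close>

definition cp11 :: "nat \<Rightarrow> nat \<Rightarrow> nat" where
  "cp11 n m = card {ps. is_partition n m ps \<and>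
     (\<forall>i. Suc i < m \<longrightarrow> ps ! Suc i - ps ! i \<ge> 2) \<and>
     (\<forall>i. Suc i < m \<longrightarrow> \<not> [ps ! i + ps ! Suc i = 1] (mod 3) \<longrightarrow> ps ! Suc i - ps ! i \<ge> 4)}"

text \<open>
  Power series in two variables \<open>q\<close> and \<open>x\<close> are elements of \<open>rat fps fps\<close>: the outer variable is
  \<open>x\<close>, and the coefficients are power series in \<open>q\<close>, embedded by \<^const>\<open>fps_const\<close>.
\<close>

abbreviation (input) q_var :: "rat fps" where "q_var \<equiv> fps_X"
abbreviation (input) x_var :: "rat fps fps" where "x_var \<equiv> fps_X"

end

theory Submission
  imports Defs
begin

text \<open>
  Let \<open>A\<^sub>j(x)\<close> count the admissible partitions with all parts at least \<open>j\<close>. Adding 3 to every part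
  preserves admissibility, so \<open>A\<^sub>j\<^sub>+\<^sub>3(x) = A\<^sub>j(x q\<^sup>3)\<close>, and removing the smallest part gives
  \<open>A\<^sub>1 - A\<^sub>2 = x q (A\<^sub>5 + x q\<^sup>3 A\<^sub>7)\<close>, \<open>A\<^sub>2 - A\<^sub>3 = x q\<^sup>2 A\<^sub>5\<close>, \<open>A\<^sub>3 - A\<^sub>4 = x q\<^sup>3 A\<^sub>7\<close>. This system determines
  \<open>A\<^sub>1, A\<^sub>2, A\<^sub>3\<close> coefficientwise in \<open>x\<close>. The double series with the exponent of \<open>q\<close> increased by
  \<open>0\<close>, \<open>n\<^sub>1 + 3 n\<^sub>2\<close> and \<open>2 n\<^sub>1 + 6 n\<^sub>2\<close>, respectively, satisfy the same system.
\<close>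

subsection \<open>The double series\<close>

definition quad_exp :: "nat \<Rightarrow> nat \<Rightarrow> nat" where
  "quad_exp n1 n2 = 6 * n2\<^sup>2 - 2 * n2 + 2 * n1\<^sup>2 - n1 + 6 * n2 * n1"

text \<open>The subtractions on \<open>nat\<close> never truncate because n <= n^2. Over
  \<open>int\<close> the recurrences below become polynomial identities.\<close>

lemma int_quad_exp:
  "int (quad_exp n1 n2) = 6 * int n2 ^ 2 - 2 * int n2 + 2 * int n1 ^ 2 - int n1 + 6 * int n2 * int n1"
proof -
  have "n1 \<le> n1\<^sup>2" "n2 \<le> n2\<^sup>2"
    by (simp_all add: power2_eq_square)
  then have "n1 \<le> 2 * n1\<^sup>2" "2 * n2 \<le> 6 * n2\<^sup>2"
    by linarith+
  then show ?thesis
    unfolding quad_exp_def by (simp add: of_nat_diff)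
qed

lemma quad_exp_Suc_left: "quad_exp (Suc n1) n2 = quad_exp n1 n2 + 4 * n1 + 6 * n2 + 1"
proof -
  have "int (quad_exp (Suc n1) n2) = int (quad_exp n1 n2 + 4 * n1 + 6 * n2 + 1)"
    by (simp add: int_quad_exp power2_eq_square algebra_simps)
  then show ?thesis
    by (simp only: of_nat_eq_iff)
qed

lemma quad_exp_Suc_right: "quad_exp n1 (Suc n2) = quad_exp n1 n2 + 6 * n1 + 12 * n2 + 4"
proof -
  have "int (quad_exp n1 (Suc n2)) = int (quad_exp n1 n2 + 6 * n1 + 12 * n2 + 4)"
    by (simp add: int_quad_exp power2_eq_square algebra_simps)
  then show ?thesis
    by (simp only: of_nat_eq_iff)
qed

section \<open>The denominators of the double series\<close>

lemma qpoch_Suc: "qpoch a q (Suc n) = qpoch a q n * (1 - a * q ^ n)"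
  by (simp add: qpoch_def)

lemma qpoch_fps_X_nth_0:
  assumes "k > 0"
  shows "fps_nth (qpoch (fps_X ^ k) (fps_X ^ k) n :: 'a::comm_ring_1 fps) 0 = 1"
  using assms by (induction n) (simp_all add: qpoch_Suc qpoch_def)

text \<open>The last factor of the product is 1 - q^(k(n+1)). It is invertible, since k > 0 makes
  its constant term 1.\<close>

lemma inverse_qpoch_Suc:
  assumes "k > 0"
  shows "inverse (qpoch (fps_X ^ k) (fps_X ^ k) (Suc n) :: 'a::field fps) * (1 - fps_X ^ (k * Suc n))
           = inverse (qpoch (fps_X ^ k) (fps_X ^ k) n)"
proof -
  have eq: "1 - fps_X ^ k * (fps_X ^ k) ^ n = (1 - fps_X ^ (k * Suc n) :: 'a fps)"
    by (simp flip: power_mult power_add)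
  have "fps_nth (1 - fps_X ^ (k * Suc n) :: 'a fps) 0 \<noteq> 0"
    using assms by simp
  then have "inverse (1 - fps_X ^ (k * Suc n) :: 'a fps) * (1 - fps_X ^ (k * Suc n)) = 1"
    by (rule inverse_mult_eq_1)
  then show ?thesis
    by (simp only: qpoch_Suc eq fps_inverse_mult mult.assoc) simp
qed

text \<open>The extra linear exponent \<open>a * n1 + b * n2\<close> gives a family closed under the
  index shifts below: shifting an index changes \<open>quad_exp\<close> by a linear form, which
  \<open>a\<close> and \<open>b\<close> absorb.\<close>

definition dterm :: "nat \<Rightarrow> nat \<Rightarrow> nat \<times> nat \<Rightarrow> rat fps" where
  "dterm a b = (\<lambda>(n1, n2). fps_X ^ (quad_exp n1 n2 + a * n1 + b * n2)
     * inverse (qpoch fps_X fps_X n1) * inverse (qpoch (fps_X ^ 3) (fps_X ^ 3) n2))"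

definition dindex :: "nat \<Rightarrow> (nat \<times> nat) set" where
  "dindex m = {(n1, n2). 2 * n2 + n1 = m}"

text \<open>The coefficient of x^m in the double series with the extra linear exponent; each such
  coefficient is a finite sum.\<close>

definition dsum :: "nat \<Rightarrow> nat \<Rightarrow> nat \<Rightarrow> rat fps" where
  "dsum a b m = (\<Sum>p\<in>dindex m. dterm a b p)"

lemma finite_dindex [simp]: "finite (dindex m)"
  by (rule finite_subset[of _ "{..m} \<times> {..m}"]) (auto simp: dindex_def)

lemma dindex_0 [simp]: "dindex 0 = {(0, 0)}"
  by (auto simp: dindex_def)

lemma dsum_0 [simp]: "dsum a b 0 = 1"
  by (simp add: dsum_def dterm_def quad_exp_def qpoch_def)

lemma dterm_eq_divide:
  "dterm 0 0 (n1, n2) = fps_X ^ quad_exp n1 n2 / (qpoch fps_X fps_X n1 * qpoch (fps_X ^ 3) (fps_X ^ 3) n2)"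
proof -
  have "fps_nth (qpoch fps_X fps_X n1 * qpoch (fps_X ^ 3) (fps_X ^ 3) n2 :: rat fps) 0 \<noteq> 0"
    using qpoch_fps_X_nth_0[of 1 n1, where ?'a = rat] qpoch_fps_X_nth_0[of 3 n2, where ?'a = rat]
    by simp
  then show ?thesis
    by (simp add: dterm_def fps_divide_unit fps_inverse_mult mult_ac)
qed

lemma dterm_diff_left_0: "dterm a b (0, n2) - dterm (Suc a) b (0, n2) = 0"
  by (simp add: dterm_def)

text \<open>Raising \<open>a\<close> by 1 multiplies the term by q^(n1+1), so the difference carries
  the factor 1 - q^(n1+1), which cancels the last factor of the first denominator. The shifts 4 and
  6 come from \<open>quad_exp_Suc_left\<close>.\<close>

lemma dterm_diff_left_Suc:
  "dterm a b (Suc n1, n2) - dterm (Suc a) b (Suc n1, n2) = fps_X ^ Suc a * dterm (a + 4) (b + 6) (n1, n2)"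
proof -
  define e where "e = quad_exp n1 n2 + 4 * n1 + 6 * n2 + 1 + a * Suc n1 + b * n2"
  have e: "quad_exp (Suc n1) n2 + a * Suc n1 + b * n2 = e"
          "quad_exp (Suc n1) n2 + Suc a * Suc n1 + b * n2 = e + Suc n1"
          "Suc a + (quad_exp n1 n2 + (a + 4) * n1 + (b + 6) * n2) = e"
    by (simp_all add: e_def quad_exp_Suc_left algebra_simps)
  have inv: "inverse (qpoch fps_X fps_X (Suc n1)) * (1 - fps_X ^ Suc n1)
               = (inverse (qpoch fps_X fps_X n1) :: rat fps)"
    using inverse_qpoch_Suc[of 1 n1, where ?'a = rat] by simp
  define R where "R = (inverse (qpoch (fps_X ^ 3) (fps_X ^ 3) n2) :: rat fps)"
  have "dterm a b (Suc n1, n2) - dterm (Suc a) b (Suc n1, n2)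
          = fps_X ^ e * R * (inverse (qpoch fps_X fps_X (Suc n1)) * (1 - fps_X ^ Suc n1))"
    unfolding dterm_def prod.case e R_def[symmetric] by (simp add: power_add algebra_simps)
  also have "\<dots> = fps_X ^ Suc a * dterm (a + 4) (b + 6) (n1, n2)"
    unfolding dterm_def prod.case inv R_def[symmetric] e(3)[symmetric] power_add[of _ "Suc a"]
    by (simp add: mult_ac)
  finally show ?thesis .
qed

lemma dterm_diff_right_0: "dterm a b (n1, 0) - dterm a (b + 3) (n1, 0) = 0"
  by (simp add: dterm_def)

text \<open>The second denominator has base q^3, so \<open>b\<close> must rise by 3 to produce its
  last factor 1 - q^(3(n2+1)). The shifts 6 and 12 come from
  \<open>quad_exp_Suc_right\<close>.\<close>

lemma dterm_diff_right_Suc: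
  "dterm a b (n1, Suc n2) - dterm a (b + 3) (n1, Suc n2) = fps_X ^ (b + 4) * dterm (a + 6) (b + 12) (n1, n2)"
proof -
  define e where "e = quad_exp n1 n2 + 6 * n1 + 12 * n2 + 4 + a * n1 + b * Suc n2"
  have e: "quad_exp n1 (Suc n2) + a * n1 + b * Suc n2 = e"
          "quad_exp n1 (Suc n2) + a * n1 + (b + 3) * Suc n2 = e + 3 * Suc n2"
          "(b + 4) + (quad_exp n1 n2 + (a + 6) * n1 + (b + 12) * n2) = e"
    by (simp_all add: e_def quad_exp_Suc_right algebra_simps)
  have inv: "inverse (qpoch (fps_X ^ 3) (fps_X ^ 3) (Suc n2)) * (1 - fps_X ^ (3 * Suc n2))
               = (inverse (qpoch (fps_X ^ 3) (fps_X ^ 3) n2) :: rat fps)"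
    by (rule inverse_qpoch_Suc) simp
  define P where "P = (inverse (qpoch fps_X fps_X n1) :: rat fps)"
  have "dterm a b (n1, Suc n2) - dterm a (b + 3) (n1, Suc n2)
          = fps_X ^ e * P * (inverse (qpoch (fps_X ^ 3) (fps_X ^ 3) (Suc n2)) * (1 - fps_X ^ (3 * Suc n2)))"
    unfolding dterm_def prod.case e P_def[symmetric] power_add[of _ e] by (simp only: algebra_simps) simp
  also have "\<dots> = fps_X ^ (b + 4) * dterm (a + 6) (b + 12) (n1, n2)"
    unfolding dterm_def prod.case inv P_def[symmetric] e(3)[symmetric] power_add[of _ "b + 4"]
    by (simp add: mult_ac)
  finally show ?thesis .
qed

text \<open>Terms with n1 = 0 cancel. In the others, lowering n1 by one uses up one factor
  x.\<close>

lemma dsum_diff_left: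
  "dsum a b (Suc m) - dsum (Suc a) b (Suc m) = fps_X ^ Suc a * dsum (a + 4) (b + 6) m"
proof -
  let ?f = "\<lambda>(n1, n2). (Suc n1, n2)"
  let ?d = "\<lambda>p. dterm a b p - dterm (Suc a) b p"
  have sub: "?f ` dindex m \<subseteq> dindex (Suc m)"
    by (auto simp: dindex_def)
  have zero: "?d p = 0" if p: "p \<in> dindex (Suc m) - ?f ` dindex m" for p
  proof (cases p)
    case (Pair n1 n2)
    have "n1 = 0"
    proof (cases n1)
      case (Suc k)
      then have "p = ?f (k, n2)" "(k, n2) \<in> dindex m"
        using p Pair by (auto simp: dindex_def)
      then show ?thesis
        using p by blast
    qed
    then show ?thesis
      using Pair dterm_diff_left_0 by simp
  qed
  have "dsum a b (Suc m) - dsum (Suc a) b (Suc m) = (\<Sum>p\<in>dindex (Suc m). ?d p)"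
    by (simp add: dsum_def sum_subtractf)
  also have "\<dots> = (\<Sum>p\<in>?f ` dindex m. ?d p)"
    by (rule sum.mono_neutral_right) (use sub zero in auto)
  also have "\<dots> = (\<Sum>p\<in>dindex m. ?d (?f p))"
    by (subst sum.reindex) (auto simp: inj_on_def)
  also have "\<dots> = fps_X ^ Suc a * dsum (a + 4) (b + 6) m"
    unfolding dsum_def sum_distrib_left
    by (rule sum.cong) (auto simp: dterm_diff_left_Suc simp del: power_Suc)
  finally show ?thesis .
qed

text \<open>An n2 > 0 would need at least x^2, so at x^1 nothing depends on
  \<open>b\<close>.\<close>

lemma dsum_diff_right_1: "dsum a b (Suc 0) - dsum a (b + 3) (Suc 0) = 0"
proof -
  have "2 * n2 + n1 = Suc 0 \<longleftrightarrow> n1 = 1 \<and> n2 = 0" for n1 n2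
    by presburger
  then have "dindex (Suc 0) = {(1, 0)}"
    by (auto simp: dindex_def)
  then show ?thesis
    by (simp add: dsum_def dterm_def)
qed

text \<open>Terms with n2 = 0 cancel. In the others, lowering n2 by one uses up x^2.\<close>

lemma dsum_diff_right:
  "dsum a b (Suc (Suc m)) - dsum a (b + 3) (Suc (Suc m)) = fps_X ^ (b + 4) * dsum (a + 6) (b + 12) m"
proof -
  let ?f = "\<lambda>(n1, n2). (n1, Suc n2)"
  let ?d = "\<lambda>p. dterm a b p - dterm a (b + 3) p"
  have sub: "?f ` dindex m \<subseteq> dindex (Suc (Suc m))"
    by (auto simp: dindex_def)
  have zero: "?d p = 0" if p: "p \<in> dindex (Suc (Suc m)) - ?f ` dindex m" for p
  proof (cases p)
    case (Pair n1 n2)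
    have "n2 = 0"
    proof (cases n2)
      case (Suc k)
      then have "p = ?f (n1, k)" "(n1, k) \<in> dindex m"
        using p Pair by (auto simp: dindex_def)
      then show ?thesis
        using p by blast
    qed
    then show ?thesis
      using Pair dterm_diff_right_0 by simp
  qed
  have "dsum a b (Suc (Suc m)) - dsum a (b + 3) (Suc (Suc m)) = (\<Sum>p\<in>dindex (Suc (Suc m)). ?d p)"
    by (simp add: dsum_def sum_subtractf)
  also have "\<dots> = (\<Sum>p\<in>?f ` dindex m. ?d p)"
    by (rule sum.mono_neutral_right) (use sub zero in auto)
  also have "\<dots> = (\<Sum>p\<in>dindex m. ?d (?f p))"
    by (subst sum.reindex) (auto simp: inj_on_def)
  also have "\<dots> = fps_X ^ (b + 4) * dsum (a + 6) (b + 12) m"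
    unfolding dsum_def sum_distrib_left
    by (rule sum.cong) (auto simp: dterm_diff_right_Suc)
  finally show ?thesis .
qed

text \<open>On \<open>dindex m\<close> the added exponent 3 n1 + 6 n2 is the constant 3m. This is
  the substitution of x q^3 for x, the counterpart of adding 3 to every part.\<close>

lemma dsum_shift: "dsum (a + 3) (b + 6) m = fps_X ^ (3 * m) * dsum a b m"
  unfolding dsum_def sum_distrib_left
proof (rule sum.cong)
  fix p assume "p \<in> dindex m"
  then obtain n1 n2 where p: "p = (n1, n2)" and m: "m = 2 * n2 + n1"
    by (auto simp: dindex_def)
  have "quad_exp n1 n2 + (a + 3) * n1 + (b + 6) * n2 = 3 * m + (quad_exp n1 n2 + a * n1 + b * n2)"
    by (simp add: m algebra_simps)
  then show "dterm (a + 3) (b + 6) p = fps_X ^ (3 * m) * dterm a b p"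
    unfolding p dterm_def prod.case by (simp only: power_add mult_ac)
qed simp

subsection \<open>Admissible lists\<close>

text \<open>Stated additively, so that it avoids truncated subtraction and forces neighbours to
  increase.\<close>

definition adm :: "nat \<Rightarrow> nat \<Rightarrow> bool" where
  "adm a b \<longleftrightarrow> a + 2 \<le> b \<and> ([a + b = 1] (mod 3) \<or> a + 4 \<le> b)"

definition adm_lists :: "nat \<Rightarrow> nat \<Rightarrow> nat list set" where
  "adm_lists j m = {ps. length ps = m \<and> successively adm ps \<and> (\<forall>p\<in>set ps. j \<le> p)}"

text \<open>As \<open>card\<close> is 0 on infinite sets, this counts correctly only when each sum
  is attained finitely often. A fixed list length ensures that.\<close>

definition list_gf :: "nat list set \<Rightarrow> 'a::semiring_1 fps" where
  "list_gf A = Abs_fps (\<lambda>n. of_nat (card {ps\<in>A. sum_list ps = n}))"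

lemma finite_lists_length_sum: "finite {ps :: nat list. length ps = m \<and> sum_list ps = n}"
  by (rule finite_subset[OF _ finite_lists_length_eq[of "{..n}" m]]) (auto intro: member_le_sum_list)

lemma list_gf_union:
  assumes "\<And>ps. ps \<in> A \<union> B \<Longrightarrow> length ps = m" "A \<inter> B = {}"
  shows "list_gf (A \<union> B) = list_gf A + list_gf B"
proof (rule fps_ext)
  fix n
  have "{ps\<in>A \<union> B. sum_list ps = n} = {ps\<in>A. sum_list ps = n} \<union> {ps\<in>B. sum_list ps = n}"
    by auto
  moreover have "finite {ps\<in>A. sum_list ps = n}" "finite {ps\<in>B. sum_list ps = n}"
    by (rule finite_subset[OF _ finite_lists_length_sum[of m n]], use assms(1) in auto)+
  ultimately show "fps_nth (list_gf (A \<union> B)) n = fps_nth (list_gf A + list_gf B) n"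
    using assms(2) by (auto simp: list_gf_def card_Un_disjoint disjoint_iff)
qed

lemma list_gf_image:
  assumes "inj_on f A" "\<And>ps. ps \<in> A \<Longrightarrow> sum_list (f ps) = k + sum_list ps"
  shows "list_gf (f ` A) = (fps_X ^ k * list_gf A :: 'a::comm_semiring_1 fps)"
proof (rule fps_ext)
  fix n
  show "fps_nth (list_gf (f ` A)) n = fps_nth (fps_X ^ k * list_gf A :: 'a fps) n"
  proof (cases "n < k")
    case True
    then have "{ps\<in>f ` A. sum_list ps = n} = {}"
      using assms(2) by auto
    then have "fps_nth (list_gf (f ` A) :: 'a fps) n = 0"
      by (simp only: list_gf_def fps_nth_Abs_fps card.empty of_nat_0)
    with True show ?thesis
      by (simp add: fps_X_power_mult_nth)
  next
    case False
    then have "{ps\<in>f ` A. sum_list ps = n} = f ` {ps\<in>A. sum_list ps = n - k}"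
      using assms(2) by auto
    moreover have "inj_on f {ps\<in>A. sum_list ps = n - k}"
      using assms(1) by (rule inj_on_subset) auto
    ultimately show ?thesis
      using False by (simp add: list_gf_def fps_X_power_mult_nth card_image)
  qed
qed

lemma list_gf_adm_lists_0: "list_gf (adm_lists j 0) = 1"
proof (rule fps_ext)
  fix n
  have "{ps\<in>adm_lists j 0. sum_list ps = n} = (if n = 0 then {[]} else {})"
    by (auto simp: adm_lists_def)
  then show "fps_nth (list_gf (adm_lists j 0)) n = fps_nth 1 n"
    by (simp add: list_gf_def)
qed

section \<open>Shifting admissible lists by 3 and removing their smallest part\<close>

lemma successively_adm_imp_le: "successively adm (p # ps) \<Longrightarrow> r \<in> set ps \<Longrightarrow> p + 2 \<le> r"
proof (induction ps arbitrary: p)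
  case (Cons a ps)
  then have "p + 2 \<le> a" "successively adm (a # ps)"
    by (auto simp: adm_def)
  with Cons show ?case
    by (cases "r = a") force+
qed simp

text \<open>The gap is unchanged and the sum of the two parts grows by 6, a multiple of 3.\<close>

lemma adm_add_3: "adm (a + 3) (b + 3) \<longleftrightarrow> adm a b"
proof -
  have "[a + 3 + (b + 3) = 1] (mod 3) \<longleftrightarrow> [a + b = 1] (mod 3)"
    unfolding cong_def by presburger
  then show ?thesis
    by (auto simp: adm_def)
qed

lemma adm_lists_add_3: "adm_lists (j + 3) m = map (\<lambda>p. p + 3) ` adm_lists j m"
proof (intro equalityI subsetI)
  fix ps assume ps: "ps \<in> adm_lists (j + 3) m"
  \<comment> \<open>All parts are at least 3, so subtracting 3 does not truncate.\<close>
  then have "map (\<lambda>p. p + 3) (map (\<lambda>p. p - 3) ps) = ps"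
    by (auto simp: adm_lists_def intro!: map_idI)
  moreover from this ps have "successively adm (map (\<lambda>p. p + 3) (map (\<lambda>p. p - 3) ps))"
    by (simp only: adm_lists_def mem_Collect_eq)
  then have "successively adm (map (\<lambda>p. p - 3) ps)"
    by (simp only: successively_map[of adm "\<lambda>p. p + 3"] adm_add_3)
  then have "map (\<lambda>p. p - 3) ps \<in> adm_lists j m"
    using ps by (auto simp: adm_lists_def)
  ultimately show "ps \<in> map (\<lambda>p. p + 3) ` adm_lists j m"
    by (metis image_eqI)
qed (auto simp: adm_lists_def successively_map adm_add_3)

lemma sum_list_map_add_const: "sum_list (map (\<lambda>p. p + k) ps) = k * length ps + sum_list (ps :: nat list)"
  by (induction ps) auto

lemma list_gf_adm_lists_add_3:
  "list_gf (adm_lists (j + 3) m) = (fps_X ^ (3 * m) * list_gf (adm_lists j m) :: 'a::comm_semiring_1 fps)"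
  unfolding adm_lists_add_3
  by (rule list_gf_image) (auto simp: sum_list_map_add_const adm_lists_def inj_on_def)

text \<open>The split is by whether the first part equals \<open>j\<close>; since the list
  increases, a first part above \<open>j\<close> puts all parts above \<open>j\<close>.\<close>

lemma adm_lists_Suc:
  "adm_lists j (Suc m) = adm_lists (Suc j) (Suc m) \<union> (#) j ` {ps\<in>adm_lists j m. successively adm (j # ps)}"
proof (intro equalityI subsetI)
  fix qs assume qs: "qs \<in> adm_lists j (Suc m)"
  then obtain p ps where eq: "qs = p # ps"
    by (cases qs) (auto simp: adm_lists_def)
  show "qs \<in> adm_lists (Suc j) (Suc m) \<union> (#) j ` {ps\<in>adm_lists j m. successively adm (j # ps)}"
  proof (cases "p = j")
    case True
    then show ?thesis
      using qs eq by (auto simp: adm_lists_def successively_Cons)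
  next
    case False
    then have "Suc j \<le> p" "\<And>r. r \<in> set ps \<Longrightarrow> p + 2 \<le> r"
      using qs eq successively_adm_imp_le by (auto simp: adm_lists_def)
    then show ?thesis
      using qs eq by (fastforce simp: adm_lists_def)
  qed
qed (auto simp: adm_lists_def)

lemma list_gf_adm_lists_Suc:
  "list_gf (adm_lists j (Suc m)) = list_gf (adm_lists (Suc j) (Suc m))
     + (fps_X ^ j * list_gf {ps\<in>adm_lists j m. successively adm (j # ps)} :: 'a::comm_semiring_1 fps)"
proof -
  have "list_gf (adm_lists j (Suc m)) = list_gf (adm_lists (Suc j) (Suc m))
     + (list_gf ((#) j ` {ps\<in>adm_lists j m. successively adm (j # ps)}) :: 'a fps)"
    by (subst adm_lists_Suc, rule list_gf_union[of _ _ "Suc m"]) (auto simp: adm_lists_def)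
  then show ?thesis
    by (simp add: list_gf_image[where k = j])
qed

text \<open>When the successors allowed after \<open>j\<close> form a full up-set, the condition on
  the tail is just a lower bound on its head, and monotonicity passes that bound to all its
  parts.\<close>

lemma successively_adm_Cons_eq_adm_lists:
  assumes "\<And>b. adm j b \<longleftrightarrow> j + d \<le> b"
  shows "{ps\<in>adm_lists j m. successively adm (j # ps)} = adm_lists (j + d) m"
proof (intro equalityI subsetI)
  fix ps assume "ps \<in> {ps\<in>adm_lists j m. successively adm (j # ps)}"
  then show "ps \<in> adm_lists (j + d) m"
  proof (cases ps)
    case (Cons p qs)
    assume *: "ps \<in> {ps\<in>adm_lists j m. successively adm (j # ps)}"
    then have "j + d \<le> p" "successively adm (p # qs)"
      using assms Cons by auto
    then show ?thesis
      using * Cons successively_adm_imp_le[of p qs] by (fastforce simp: adm_lists_def)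
  qed (auto simp: adm_lists_def)
next
  fix ps assume "ps \<in> adm_lists (j + d) m"
  then show "ps \<in> {ps\<in>adm_lists j m. successively adm (j # ps)}"
    using assms by (cases ps) (auto simp: adm_lists_def)
qed

text \<open>After a part j, a gap of 2 needs 2j + 2 = 1 mod 3, that is j = 1 mod 3; a gap of 3 needs
  j = 2 mod 3. Hence only j = 1 leaves a hole among its successors, at 4.\<close>

lemma adm_1: "adm (Suc 0) b \<longleftrightarrow> b = 3 \<or> 5 \<le> b"
  unfolding adm_def cong_def by presburger

lemma adm_2: "adm 2 b \<longleftrightarrow> 2 + 3 \<le> b"
  unfolding adm_def cong_def by presburger

lemma adm_3: "adm 3 b \<longleftrightarrow> 3 + 4 \<le> b"
  unfolding adm_def cong_def by presburger

lemma gf_diff_2: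
  "list_gf (adm_lists 2 (Suc m)) =
     list_gf (adm_lists 3 (Suc m)) + (fps_X ^ 2 * list_gf (adm_lists 5 m) :: 'a::comm_semiring_1 fps)"
  using list_gf_adm_lists_Suc[of 2 m, where ?'a = 'a] successively_adm_Cons_eq_adm_lists[OF adm_2, of m]
  by (simp del: successively.simps)

lemma gf_diff_3:
  "list_gf (adm_lists 3 (Suc m)) =
     list_gf (adm_lists 4 (Suc m)) + (fps_X ^ 3 * list_gf (adm_lists 7 m) :: 'a::comm_semiring_1 fps)"
  using list_gf_adm_lists_Suc[of 3 m, where ?'a = 'a] successively_adm_Cons_eq_adm_lists[OF adm_3, of m]
  by (simp del: successively.simps)

lemma gf_diff_1_1:
  "list_gf (adm_lists 1 (Suc 0)) = list_gf (adm_lists 2 (Suc 0)) + (fps_X :: 'a::comm_semiring_1 fps)"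
proof -
  have "{ps\<in>adm_lists 1 0. successively adm (1 # ps)} = adm_lists 1 0"
    by (auto simp: adm_lists_def)
  then show ?thesis
    using list_gf_adm_lists_Suc[of 1 0, where ?'a = 'a] by (simp add: list_gf_adm_lists_0 numeral_2_eq_2)
qed

text \<open>After a part 1 the next part is either at least 5 or exactly 3, and what follows a 3 is
  at least 7. The second case consumes two parts, hence the drop to \<open>m\<close>.\<close>

lemma gf_diff_1:
  "list_gf (adm_lists 1 (Suc (Suc m))) = list_gf (adm_lists 2 (Suc (Suc m)))
     + (fps_X * (list_gf (adm_lists 5 (Suc m)) + fps_X ^ 3 * list_gf (adm_lists 7 m)) :: 'a::comm_semiring_1 fps)"
proof -
  have "{ps\<in>adm_lists 1 (Suc m). successively adm (1 # ps)} = adm_lists 5 (Suc m) \<union> (#) 3 ` adm_lists 7 m"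
    (is "?L = ?R")
  proof (intro equalityI subsetI)
    fix ps assume ps: "ps \<in> ?L"
    then obtain p qs where eq: "ps = p # qs"
      by (cases ps) (auto simp: adm_lists_def)
    have p: "p = 3 \<or> 5 \<le> p" and succ: "successively adm (p # qs)" and len: "length qs = m"
      using ps eq by (auto simp: adm_1 adm_lists_def)
    show "ps \<in> ?R"
    proof (cases "p = 3")
      case True
      then have "qs \<in> {ps\<in>adm_lists 3 m. successively adm (3 # ps)}"
        using succ len successively_adm_imp_le[of p qs]
        by (fastforce simp: adm_lists_def successively_Cons)
      then have "qs \<in> adm_lists 7 m"
        using successively_adm_Cons_eq_adm_lists[OF adm_3, of m] by simp
      then show ?thesis
        using eq True by blast
    next
      case False
      then show ?thesis
        using p succ len eq successively_adm_imp_le[of p qs] by (fastforce simp: adm_lists_def)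
    qed
  next
    fix ps assume ps: "ps \<in> ?R"
    have "(3 # qs) \<in> ?L" if "qs \<in> adm_lists 7 m" for qs
    proof -
      have "qs \<in> {ps\<in>adm_lists 3 m. successively adm (3 # ps)}"
        using that successively_adm_Cons_eq_adm_lists[OF adm_3, of m] by simp
      then show ?thesis
        by (fastforce simp: adm_lists_def adm_1)
    qed
    moreover have "ps \<in> ?L" if "ps \<in> adm_lists 5 (Suc m)"
      using that by (fastforce simp: adm_lists_def successively_Cons adm_1)
    ultimately show "ps \<in> ?L"
      using ps by blast
  qed
  moreover have "list_gf (adm_lists 5 (Suc m) \<union> (#) 3 ` adm_lists 7 m)
      = list_gf (adm_lists 5 (Suc m)) + (list_gf ((#) 3 ` adm_lists 7 m) :: 'a fps)"
    by (rule list_gf_union[of _ _ "Suc m"]) (auto simp: adm_lists_def)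
  moreover have "list_gf ((#) 3 ` adm_lists 7 m) = (fps_X ^ 3 * list_gf (adm_lists 7 m) :: 'a fps)"
    by (rule list_gf_image) auto
  ultimately show ?thesis
    using list_gf_adm_lists_Suc[of 1 "Suc m", where ?'a = 'a] by (simp add: numeral_2_eq_2)
qed

subsection \<open>The common \<open>q\<close>-difference system\<close>

lemma dsum_system_1_1: "dsum 0 0 (Suc 0) = dsum 1 3 (Suc 0) + fps_X"
  using dsum_diff_left[of 0 0 0] dsum_diff_right_1[of 1 0] by (simp add: algebra_simps)

text \<open>Raising \<open>a\<close> and then \<open>b\<close> gives the terms
  \<open>dsum 4 6\<close> and \<open>dsum 7 12\<close> instead of the desired
  \<open>dsum 4 9\<close> and \<open>dsum 6 12\<close>. Both corrections are multiples of
  \<open>dsum 10 18 k\<close>, and they agree because q * q^10 = q^4 * q^7.\<close>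

lemma dsum_system_1:
  "dsum 0 0 (Suc (Suc m)) = dsum 1 3 (Suc (Suc m)) + fps_X * (dsum 4 9 (Suc m) + fps_X ^ 3 * dsum 6 12 m)"
proof (cases m)
  case 0
  \<comment> \<open>Here the corrections vanish: \<open>dsum 4 6\<close> and \<open>dsum 4 9\<close>
    agree at x^1, and every \<open>dsum\<close> is 1 at x^0.\<close>
  have "dsum 0 0 2 = dsum 1 3 2 + fps_X * dsum 4 6 1 + fps_X ^ 4"
    using dsum_diff_left[of 0 0 1] dsum_diff_right[of 1 0 0] by (simp add: algebra_simps numeral_2_eq_2)
  then show ?thesis
    using dsum_diff_right_1[of 4 6] 0 by (simp add: algebra_simps numeral_2_eq_2 power_numeral_reduce)
next
  case (Suc k)
  have "dsum 0 0 (Suc (Suc m)) = dsum 1 0 (Suc (Suc m)) + fps_X * dsum 4 6 (Suc m)"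
    using dsum_diff_left[of 0 0 "Suc m"] by (simp add: algebra_simps)
  moreover have "dsum 1 0 (Suc (Suc m)) = dsum 1 3 (Suc (Suc m)) + fps_X ^ 4 * dsum 7 12 m"
    using dsum_diff_right[of 1 0 m] by (simp add: algebra_simps)
  moreover have "dsum 4 6 (Suc m) = dsum 4 9 (Suc m) + fps_X ^ 10 * dsum 10 18 k"
    using dsum_diff_right[of 4 6 k] Suc by (simp add: algebra_simps)
  moreover have "dsum 6 12 m = dsum 7 12 m + fps_X ^ 7 * dsum 10 18 k"
    using dsum_diff_left[of 6 12 k] Suc by (simp add: algebra_simps)
  ultimately show ?thesis
    by (simp add: algebra_simps power_numeral_reduce)
qed

text \<open>The same exchange: replacing \<open>dsum 5 9\<close> by \<open>dsum 4 9\<close> costs a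
  multiple of \<open>dsum 8 15 k\<close>, which the step in \<open>b\<close> supplies, as q^2 * q^5
  = q^7.\<close>

lemma dsum_system_2: "dsum 1 3 (Suc m) = dsum 2 6 (Suc m) + fps_X ^ 2 * dsum 4 9 m"
proof (cases m)
  case 0
  then show ?thesis
    using dsum_diff_left[of 1 3 0] dsum_diff_right_1[of 2 3] by (simp add: algebra_simps numeral_2_eq_2)
next
  case (Suc k)
  have "dsum 1 3 (Suc m) = dsum 2 3 (Suc m) + fps_X ^ 2 * dsum 5 9 m"
    using dsum_diff_left[of 1 3 m] by (simp add: algebra_simps numeral_2_eq_2)
  moreover have "dsum 2 3 (Suc m) = dsum 2 6 (Suc m) + fps_X ^ 7 * dsum 8 15 k"
    using dsum_diff_right[of 2 3 k] Suc by (simp add: algebra_simps)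
  moreover have "dsum 4 9 m = dsum 5 9 m + fps_X ^ 5 * dsum 8 15 k"
    using dsum_diff_left[of 4 9 k] Suc by (simp add: algebra_simps)
  ultimately show ?thesis
    by (simp add: algebra_simps power_numeral_reduce)
qed

text \<open>This closes the cycle, since \<open>dsum 3 6\<close> is the shift of
  \<open>dsum 0 0\<close>.\<close>

lemma dsum_system_3: "dsum 2 6 (Suc m) = dsum 3 6 (Suc m) + fps_X ^ 3 * dsum 6 12 m"
  using dsum_diff_left[of 2 6 m] by (simp add: algebra_simps numeral_3_eq_3)

text \<open>Beyond differences of unknowns at x^m, the three equations involve only lower
  coefficients, known by induction. Adding them up compares the first unknown with its own shift by
  q^(3m). The second conjunct is carried along because lists with parts at least 5 = 2 + 3
  occur.\<close>

lemma list_gf_adm_lists_eq_dsum: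
  "list_gf (adm_lists 1 m) = dsum 0 0 m \<and> list_gf (adm_lists 2 m) = dsum 1 3 m"
proof (induction m rule: less_induct)
  case (less m)
  have gf5: "list_gf (adm_lists 5 k) = dsum 4 9 k" if "k < m" for k
    using less.IH[OF that] list_gf_adm_lists_add_3[of 2 k, where ?'a = rat] dsum_shift[of 1 3 k] by simp
  \<comment> \<open>Two shifts are needed: 7 = 1 + 3 + 3 and (6, 12) = (0, 0) + 2 (3, 6).\<close>
  have gf7: "list_gf (adm_lists 7 k) = dsum 6 12 k" if "k < m" for k
    using less.IH[OF that] list_gf_adm_lists_add_3[of 1 k, where ?'a = rat] dsum_shift[of 0 0 k]
      list_gf_adm_lists_add_3[of 4 k, where ?'a = rat] dsum_shift[of 3 6 k] by simp
  show ?case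
  proof (cases m)
    case 0
    then show ?thesis
      by (simp add: list_gf_adm_lists_0)
  next
    case m: (Suc k)
    let ?C = "\<lambda>j. list_gf (adm_lists j m) :: rat fps"
    have d1: "?C 1 - ?C 2 = dsum 0 0 m - dsum 1 3 m"
    proof (cases k)
      case 0
      then show ?thesis
        using gf_diff_1_1[where ?'a = rat] dsum_system_1_1 m by simp
    next
      case (Suc l)
      then show ?thesis
        using gf_diff_1[of l, where ?'a = rat] dsum_system_1[of l] gf5[of k] gf7[of l] m by simp
    qed
    have d2: "?C 2 - ?C 3 = dsum 1 3 m - dsum 2 6 m"
      using gf_diff_2[of k, where ?'a = rat] dsum_system_2[of k] gf5[of k] m by simp
    have d3: "?C 3 - ?C 4 = dsum 2 6 m - dsum 3 6 m"
      using gf_diff_3[of k, where ?'a = rat] dsum_system_3[of k] gf7[of k] m by simp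
    have "?C 1 - ?C 4 = dsum 0 0 m - dsum 3 6 m"
      using d1 d2 d3 by algebra
    moreover have "?C 4 = fps_X ^ (3 * m) * ?C 1" "dsum 3 6 m = fps_X ^ (3 * m) * dsum 0 0 m"
      using list_gf_adm_lists_add_3[of 1 m, where ?'a = rat] dsum_shift[of 0 0 m] by simp_all
    ultimately have "(1 - fps_X ^ (3 * m)) * ?C 1 = (1 - fps_X ^ (3 * m)) * dsum 0 0 m"
      by (simp add: algebra_simps)
    \<comment> \<open>Since m > 0, the common factor is nonzero and can be cancelled.\<close>
    moreover have "fps_nth (1 - fps_X ^ (3 * m) :: rat fps) 0 \<noteq> 0"
      using m by simp
    then have "(1 - fps_X ^ (3 * m) :: rat fps) \<noteq> 0"
      by (metis fps_zero_nth)
    ultimately have "?C 1 = dsum 0 0 m"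
      using mult_left_cancel by blast
    then show ?thesis
      using d1 by simp
  qed
qed

section \<open>From \<open>cp11\<close> to admissible lists, and the summation of the double
  series\<close>

lemma successively_conv_nth:
  "successively P ps \<longleftrightarrow> (\<forall>i. Suc i < length ps \<longrightarrow> P (ps ! i) (ps ! Suc i))"
proof (induction P ps rule: successively.induct)
  case (3 P x y xs)
  then show ?case
    by (auto simp: nth_Cons split: nat.splits)
qed auto

text \<open>A truncated difference that is at least 2 or 4 is a genuine gap, so the subtractions in
  \<open>cp11\<close> agree with the additive form in \<open>adm\<close>. Sortedness follows from
  the gaps, and positivity is the bound 1.\<close>

lemma cp11_eq_card: "cp11 n m = card {ps\<in>adm_lists 1 m. sum_list ps = n}"
proof -
  have "is_partition n m ps \<and>
     (\<forall>i. Suc i < m \<longrightarrow> ps ! Suc i - ps ! i \<ge> 2) \<and>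
     (\<forall>i. Suc i < m \<longrightarrow> \<not> [ps ! i + ps ! Suc i = 1] (mod 3) \<longrightarrow> ps ! Suc i - ps ! i \<ge> 4)
     \<longleftrightarrow> ps \<in> adm_lists 1 m \<and> sum_list ps = n" (is "?L \<longleftrightarrow> ?R") for ps
  proof
    assume L: ?L
    have "adm (ps ! i) (ps ! Suc i)" if "Suc i < length ps" for i
      using L that by (fastforce simp: adm_def is_partition_def)
    then show ?R
      using L by (auto simp: adm_lists_def is_partition_def successively_conv_nth Suc_le_eq)
  next
    assume R: ?R
    then have "successively adm ps" and len: "length ps = m"
      by (auto simp: adm_lists_def)
    then have *: "adm (ps ! i) (ps ! Suc i)" if "Suc i < m" for i
      using that by (simp add: successively_conv_nth)
    then have "ps ! i \<le> ps ! Suc i" if "Suc i < m" for i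
      using that by (fastforce simp: adm_def)
    then have "sorted ps"
      using len by (simp add: sorted_iff_nth_Suc)
    moreover have "ps ! Suc i - ps ! i \<ge> 2" if "Suc i < m" for i
      using *[OF that] by (auto simp: adm_def)
    moreover have "ps ! Suc i - ps ! i \<ge> 4" if "Suc i < m" "\<not> [ps ! i + ps ! Suc i = 1] (mod 3)" for i
      using *[OF that(1)] that(2) by (auto simp: adm_def)
    ultimately show ?L
      using R by (auto simp: is_partition_def adm_lists_def)
  qed
  then show ?thesis
    unfolding cp11_def by simp
qed

theorem theorem11:
  shows "((\<lambda>(n1, n2).
            fps_const (q_var ^ (6 * n2\<^sup>2 - 2 * n2 + 2 * n1\<^sup>2 - n1 + 6 * n2 * n1)
                       / (qpoch q_var q_var n1 * qpoch (q_var ^ 3) (q_var ^ 3) n2))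
            * x_var ^ (2 * n2 + n1))
          has_sum Abs_fps (\<lambda>m. Abs_fps (\<lambda>n. of_nat (cp11 n m)))) UNIV"
  (is "(?F has_sum ?S) UNIV")
proof -
  have F: "fps_nth (?F p) m = (if p \<in> dindex m then dterm 0 0 p else 0)" for p m
    by (cases p) (auto simp: dindex_def dterm_eq_divide quad_exp_def fps_X_power_nth)
  \<comment> \<open>For each power of x only finitely many summands contribute, so
    \<open>has_sum_fpsI\<close> reduces the infinite sum to one finite sum per coefficient.\<close>
  have sub: "{p \<in> UNIV. fps_nth (?F p) m \<noteq> 0} \<subseteq> dindex m" for m
    unfolding F by auto
  show ?thesis
  proof (rule has_sum_fpsI)
    fix m
    show "finite {p \<in> UNIV. fps_nth (?F p) m \<noteq> 0}"
      using sub finite_dindex by (rule finite_subset)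
    have "fps_nth ?S m = list_gf (adm_lists 1 m)"
      by (simp add: list_gf_def cp11_eq_card)
    also have "\<dots> = (\<Sum>p\<in>dindex m. fps_nth (?F p) m)"
      by (simp add: list_gf_adm_lists_eq_dsum dsum_def F del: One_nat_def)
    also have "\<dots> = (\<Sum>p | p \<in> UNIV \<and> fps_nth (?F p) m \<noteq> 0. fps_nth (?F p) m)"
      by (rule sum.mono_neutral_right) (use sub in auto)
    finally show "fps_nth ?S m = (\<Sum>p | p \<in> UNIV \<and> fps_nth (?F p) m \<noteq> 0. fps_nth (?F p) m)" .
  qed
qed

end
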